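(* Let $\Omega\subset\mathbb{R}^2$ be a bounded domain with $C^3$ boundary, $\mathbf{u}\in C^1$, and assume M-convergence $\delta=Mh$ with $M>0$ fixed. For $\mathbf{x}\in\mathcal{I}\Omega_N$ let $\hat{\mathbf{n}},\hat{\mathbf{p}}$ be perturbed orthonormal vectors with $|\hat{\mathbf{n}}-\mathbf{n}|=O(h)$, $|\hat{\mathbf{p}}-\mathbf{p}|=O(h)$, and let $\hat{\mathbf{T}}$ be a perturbed traction whose components satisfy $$\hat T_p(\overline{\mathbf{x}})=\mu\Big(\frac{\partial u_p}{\partial\mathbf{n}}(\mathbf{x})+\frac{\partial u_n}{\partial\mathbf{p}}(\mathbf{x})\Big)+O(h),\qquad \hat T_n(\overline{\mathbf{x}})=\lambda\nabla\cdot\mathbf{u}(\mathbf{x})+2\mu\frac{\partial u_n}{\partial\mathbf{n}}(\mathbf{x})+O(h),$$ where $u_p,u_n$ are the components of $\mathbf{u}$ along the unperturbed $\mathbf{p},\mathbf{n}$. Let $\hat{\mathcal{L}}_{N\delta}$ and $\hat{\mathbf{f}}_{N\delta}$ be $\mathcal{L}_{N\delta}$ and $\mathbf{f}_{N\delta}$ with $\mathbf{n},\mathbf{p},T_p,T_n$ replaced by $\hat{\mathbf{n}},\hat{\mathbf{p}},\hat T_p,\hat T_n$ (the dilatation $\theta$ is unchanged). Then for $\mathbf{x}\in\mathcal{I}\Omega_N$, $$\big|\hat{\mathcal{L}}_{N\delta}\mathbf{u}(\mathbf{x})-\hat{\mathbf{f}}_{N\delta}(\mathbf{x})-\mathcal{L}_{N\delta}\mathbf{u}(\mathbf{x})+\mathbf{f}_{N\delta}(\mathbf{x})\big|=O(1),$$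 with constant independent of $h$, $\delta$ and $\mathbf{x}$; here $\mathbf{f}_{N\delta}$ uses the unperturbed traction $T_p=\mu(\partial_{\mathbf{n}}u_p+\partial_{\mathbf{p}}u_n)$, $T_n=\lambda\nabla\cdot\mathbf{u}+2\mu\partial_{\mathbf{n}}u_n$.
   Context: Dimension $d=2$; $C_\alpha=2$, $C_\beta=16$; Lamé constants $\lambda,\mu>0$. Kernel $K(r)=1/r$ for $0<r\le\delta$, $0$ otherwise; $m(\delta)=\int_{B_\delta(\mathbf{x})}K|\mathbf{y}-\mathbf{x}|^2d\mathbf{y}$. $\mathcal{I}\Omega_N=\{\mathbf{x}\in\Omega:\operatorname{dist}(\mathbf{x},\partial\Omega_N)<\delta\}$ with $\partial\Omega_N\subset\partial\Omega$ the traction boundary; $\overline{\mathbf{x}}$ the nearest point on $\partial\Omega_N$, $\mathbf{n},\mathbf{p}$ the outward unit normal and unit tangent there. Dilatation on $\mathcal{I}\Omega_N$: $\theta(\mathbf{x})=\frac{d}{m(\delta)}\int_{B_\delta(\mathbf{x})\cap\Omega}K(\mathbf{y}-\mathbf{x})\cdot\mathbf{M}(\mathbf{x})(\mathbf{u}(\mathbf{y})-\mathbf{u}(\mathbf{x}))d\mathbf{y}$, $\mathbf{M}(\mathbf{x})=[\frac{d}{m(\delta)}\int_{B_\delta(\mathbf{x})\cap\Omega}K(\mathbf{y}-\mathbf{x})\otimes(\mathbf{y}-\mathbf{x})d\mathbf{y}]^{-1}$ (and uncorrected $\theta(\mathbf{y})=\frac{d}{m(\delta)}\int_{B_\delta(\mathbf{y})}K(\mathbf{w}-\mathbf{y})\cdot(\mathbf{u}(\mathbf{w})-\mathbf{u}(\mathbf{y}))d\mathbf{w}$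 away from $\mathcal{I}\Omega_N$). With $\mathbf{z}=\mathbf{y}-\mathbf{x}$: $\mathcal{L}_{N\delta}\mathbf{u}(\mathbf{x})=-\frac{C_\alpha}{m(\delta)}\int_{B_\delta(\mathbf{x})\cap\Omega}(\lambda-\mu)K\mathbf{z}(\theta(\mathbf{x})+\theta(\mathbf{y}))d\mathbf{y}-\frac{C_\beta}{m(\delta)}\int_{B_\delta(\mathbf{x})\cap\Omega}\mu K\frac{\mathbf{z}\otimes\mathbf{z}}{|\mathbf{z}|^2}(\mathbf{u}(\mathbf{y})-\mathbf{u}(\mathbf{x}))d\mathbf{y}-\frac{2C_\alpha\theta(\mathbf{x})}{m(\delta)}\int_{B_\delta(\mathbf{x})\setminus\Omega}(\lambda-\mu)K\mathbf{z}d\mathbf{y}-\frac{C_\beta\theta(\mathbf{x})}{2m(\delta)}\int_{B_\delta(\mathbf{x})\setminus\Omega}(\lambda+2\mu)K\frac{(\mathbf{z}\cdot\mathbf{n})(\mathbf{z}\cdot\mathbf{p})^2}{|\mathbf{z}|^2}\mathbf{n}d\mathbf{y}+\frac{C_\beta\theta(\mathbf{x})}{2m(\delta)}\int_{B_\delta(\mathbf{x})\setminus\Omega}\lambda K\frac{(\mathbf{z}\cdot\mathbf{n})^3}{|\mathbf{z}|^2}\mathbf{n}d\mathbf{y}$; $\mathbf{f}_{N\delta}(\mathbf{x})=\mathbf{f}(\mathbf{x})+\frac{C_\beta}{m(\delta)}\int_{B_\delta(\mathbf{x})\setminus\Omega}K\frac{(\mathbf{z}\cdot\mathbf{n})(\mathbf{z}\cdot\mathbf{p})^2}{|\mathbf{z}|^2}T_p\mathbf{p}d\mathbf{y}+\frac{C_\beta}{2m(\delta)}\int_{B_\delta(\mathbf{x})\setminus\Omega}K\frac{(\mathbf{z}\cdot\mathbf{n})((\mathbf{z}\cdot\mathbf{n})^2-(\mathbf{z}\cdot\mathbf{p})^2)}{|\mathbf{z}|^2}T_n\mathbf{n}d\mathbf{y}$.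 $h$ is the discretization fill distance. *)

theory Defs
  imports "HOL-Analysis.Analysis"
begin

type_synonym vec2 = "real^2"

definition dimd :: real where "dimd = 2"
definition C_alpha :: real where "C_alpha = 2"
definition C_beta :: real where "C_beta = 16"

definition Kker :: "real \<Rightarrow> real \<Rightarrow> real" where
  "Kker \<delta> r = (if 0 < r \<and> r \<le> \<delta> then 1 / r else 0)"

definition mdelta :: "real \<Rightarrow> real" where
  "mdelta \<delta> = integral (ball (0::vec2) \<delta>) (\<lambda>z. Kker \<delta> (norm z) * (norm z)\<^sup>2)"

definition outer2 :: "vec2 \<Rightarrow> vec2 \<Rightarrow> real^2^2" where
  "outer2 a b = (\<chi> i j. a $ i * b $ j)"

definition C3_fun :: "(real \<Rightarrow> real) \<Rightarrow> bool" where
  "C3_fun g \<longleftrightarrow>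
     (\<forall>k<3. \<forall>s. ((deriv ^^ k) g has_real_derivative (deriv ^^ Suc k) g s) (at s))
     \<and> continuous_on UNIV ((deriv ^^ 3) g)"

definition C3_boundary :: "vec2 set \<Rightarrow> bool" where
  "C3_boundary \<Omega> \<longleftrightarrow>
     (\<forall>b\<in>frontier \<Omega>. \<exists>r>0. \<exists>Q::real^2^2. \<exists>g. orthogonal_matrix Q \<and> C3_fun g \<and>
        \<Omega> \<inter> ball b r =
          {y \<in> ball b r. (transpose Q *v (y - b)) $ 2 < g ((transpose Q *v (y - b)) $ 1)})"

definition bounded_domain :: "vec2 set \<Rightarrow> bool" where
  "bounded_domain \<Omega> \<longleftrightarrow> open \<Omega> \<and> connected \<Omega> \<and> bounded \<Omega> \<and> \<Omega> \<noteq> {}"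

definition is_outward_unit_normal :: "vec2 set \<Rightarrow> vec2 \<Rightarrow> vec2 \<Rightarrow> bool" where
  "is_outward_unit_normal \<Omega> b \<nu> \<longleftrightarrow>
     norm \<nu> = 1
     \<and> (\<exists>r>0. \<forall>t. 0 < t \<and> t < r \<longrightarrow> b + t *\<^sub>R \<nu> \<notin> closure \<Omega> \<and> b - t *\<^sub>R \<nu> \<in> \<Omega>)
     \<and> ((\<lambda>y. (\<nu> \<bullet> (y - b)) / norm (y - b)) \<longlongrightarrow> 0) (at b within frontier \<Omega>)"

definition out_normal :: "vec2 set \<Rightarrow> vec2 \<Rightarrow> vec2" where
  "out_normal \<Omega> b = (SOME \<nu>. is_outward_unit_normal \<Omega> b \<nu>)"

text \<open>Unit tangent: the normal rotated by +90 degrees (the sign is immaterial).\<close>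
definition tangent_of :: "vec2 \<Rightarrow> vec2" where
  "tangent_of \<nu> = vector [- (\<nu> $ 2), \<nu> $ 1]"

definition nearest :: "vec2 set \<Rightarrow> vec2 \<Rightarrow> vec2" where
  "nearest \<Gamma> x = (SOME y. y \<in> \<Gamma> \<and> dist x y = infdist x \<Gamma>)"

definition IOmegaN :: "real \<Rightarrow> vec2 set \<Rightarrow> vec2 set \<Rightarrow> vec2 set" where
  "IOmegaN \<delta> \<Omega> \<Gamma> = {x \<in> \<Omega>. infdist x \<Gamma> < \<delta>}"

text \<open>Shape matrix M(x) (K(z) as a vector means K(|z|) z).\<close>
definition Mmat :: "real \<Rightarrow> vec2 set \<Rightarrow> vec2 \<Rightarrow> real^2^2" where
  "Mmat \<delta> \<Omega> x = matrix_inv ((dimd / mdelta \<delta>) *\<^sub>R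
      integral (ball x \<delta> \<inter> \<Omega>) (\<lambda>y. Kker \<delta> (norm (y - x)) *\<^sub>R outer2 (y - x) (y - x)))"

definition theta_corr :: "real \<Rightarrow> vec2 set \<Rightarrow> (vec2 \<Rightarrow> vec2) \<Rightarrow> vec2 \<Rightarrow> real" where
  "theta_corr \<delta> \<Omega> u x = (dimd / mdelta \<delta>) *
      integral (ball x \<delta> \<inter> \<Omega>)
        (\<lambda>y. Kker \<delta> (norm (y - x)) * ((y - x) \<bullet> (Mmat \<delta> \<Omega> x *v (u y - u x))))"

definition theta_unc :: "real \<Rightarrow> (vec2 \<Rightarrow> vec2) \<Rightarrow> vec2 \<Rightarrow> real" where
  "theta_unc \<delta> u y = (dimd / mdelta \<delta>) *
      integral (ball y \<delta>) (\<lambda>w. Kker \<delta> (norm (w - y)) * ((w - y) \<bullet> (u w - u y)))"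

definition theta :: "real \<Rightarrow> vec2 set \<Rightarrow> vec2 set \<Rightarrow> (vec2 \<Rightarrow> vec2) \<Rightarrow> vec2 \<Rightarrow> real" where
  "theta \<delta> \<Omega> \<Gamma> u y = (if y \<in> IOmegaN \<delta> \<Omega> \<Gamma> then theta_corr \<delta> \<Omega> u y else theta_unc \<delta> u y)"

definition LNop :: "real \<Rightarrow> vec2 set \<Rightarrow> vec2 set \<Rightarrow> real \<Rightarrow> real \<Rightarrow> vec2 \<Rightarrow> vec2 \<Rightarrow>
                    (vec2 \<Rightarrow> vec2) \<Rightarrow> vec2 \<Rightarrow> vec2" where
  "LNop \<delta> \<Omega> \<Gamma> lam mu nv pv u x =
    (let m = mdelta \<delta>; th = theta \<delta> \<Omega> \<Gamma> u; K = (\<lambda>z. Kker \<delta> (norm z)) in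
     - (C_alpha / m) *\<^sub>R integral (ball x \<delta> \<inter> \<Omega>)
          (\<lambda>y. ((lam - mu) * K (y - x) * (th x + th y)) *\<^sub>R (y - x))
     - (C_beta / m) *\<^sub>R integral (ball x \<delta> \<inter> \<Omega>)
          (\<lambda>y. (mu * K (y - x) * ((y - x) \<bullet> (u y - u x)) / (norm (y - x))\<^sup>2) *\<^sub>R (y - x))
     - (2 * C_alpha * th x / m) *\<^sub>R integral (ball x \<delta> - \<Omega>)
          (\<lambda>y. ((lam - mu) * K (y - x)) *\<^sub>R (y - x))
     - (C_beta * th x / (2 * m)) *\<^sub>R integral (ball x \<delta> - \<Omega>)
          (\<lambda>y. ((lam + 2 * mu) * K (y - x) * ((y - x) \<bullet> nv) * ((y - x) \<bullet> pv)\<^sup>2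
                  / (norm (y - x))\<^sup>2) *\<^sub>R nv)
     + (C_beta * th x / (2 * m)) *\<^sub>R integral (ball x \<delta> - \<Omega>)
          (\<lambda>y. (lam * K (y - x) * ((y - x) \<bullet> nv) ^ 3 / (norm (y - x))\<^sup>2) *\<^sub>R nv))"

definition fNop :: "real \<Rightarrow> vec2 set \<Rightarrow> (vec2 \<Rightarrow> vec2) \<Rightarrow> vec2 \<Rightarrow> vec2 \<Rightarrow> real \<Rightarrow> real \<Rightarrow>
                    vec2 \<Rightarrow> vec2" where
  "fNop \<delta> \<Omega> f nv pv Tp Tn x =
    (let m = mdelta \<delta>; K = (\<lambda>z. Kker \<delta> (norm z)) in
     f x
     + (C_beta / m) *\<^sub>R integral (ball x \<delta> - \<Omega>)
          (\<lambda>y. (K (y - x) * ((y - x) \<bullet> nv) * ((y - x) \<bullet> pv)\<^sup>2 / (norm (y - x))\<^sup>2 * Tp) *\<^sub>R pv)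
     + (C_beta / (2 * m)) *\<^sub>R integral (ball x \<delta> - \<Omega>)
          (\<lambda>y. (K (y - x) * ((y - x) \<bullet> nv) * (((y - x) \<bullet> nv)\<^sup>2 - ((y - x) \<bullet> pv)\<^sup>2)
                 / (norm (y - x))\<^sup>2 * Tn) *\<^sub>R nv))"

definition div2 :: "(vec2 \<Rightarrow> vec2) \<Rightarrow> vec2 \<Rightarrow> real" where
  "div2 u x = (\<Sum>i\<in>UNIV. (frechet_derivative u (at x) (axis i 1)) $ i)"

definition Tp_exact :: "real \<Rightarrow> (vec2 \<Rightarrow> vec2) \<Rightarrow> vec2 \<Rightarrow> vec2 \<Rightarrow> vec2 \<Rightarrow> real" where
  "Tp_exact mu u nv pv x =
     mu * (pv \<bullet> frechet_derivative u (at x) nv + nv \<bullet> frechet_derivative u (at x) pv)"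

definition Tn_exact :: "real \<Rightarrow> real \<Rightarrow> (vec2 \<Rightarrow> vec2) \<Rightarrow> vec2 \<Rightarrow> vec2 \<Rightarrow> real" where
  "Tn_exact lam mu u nv x = lam * div2 u x + 2 * mu * (nv \<bullet> frechet_derivative u (at x) nv)"

end

theory Submission
  imports Defs
begin

text \<open>
  The perturbation of the normal, the tangent and the traction changes only the integrals over the
  part of the horizon outside the domain. These are trilinear forms in the normal and the
  tangent, of size \<open>O(\<delta>\<^sup>2)\<close>, so an \<open>O(h)\<close> perturbation changes them by \<open>O(h \<delta>\<^sup>2)\<close>, which after
  division by \<open>m(\<delta>) \<sim> \<delta>\<^sup>3\<close> is \<open>O(1)\<close>. The integrals are multiplied by \<open>\<theta>(x)\<close>, so it remains to
  bound the dilatation uniformly, that is, to bound the inverse of the shape matrix. As the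
  boundary is locally a Lipschitz graph, the set \<open>B\<^sub>\<delta>(x) \<inter> \<Omega>\<close> contains a ball of radius
  \<open>\<kappa> \<delta>\<close> with \<open>\<kappa>\<close> independent of \<open>x\<close> and \<open>\<delta>\<close>, and this ball alone makes the shape matrix uniformly
  positive definite.
\<close>

section \<open>Integrals of bounded functions\<close>

lemma norm_integral_le_measure:
  fixes f :: "'a::euclidean_space \<Rightarrow> 'b::euclidean_space"
  assumes S: "S \<in> lmeasurable" and B: "0 \<le> B" "\<And>x. x \<in> S \<Longrightarrow> norm (f x) \<le> B"
  shows "norm (integral S f) \<le> B * measure lebesgue S"
proof (cases "f integrable_on S")
  case True
  have "norm (integral S f) \<le> integral S (\<lambda>x. B)"
    using True integrable_on_const[OF S] B by (intro integral_norm_bound_integral) auto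
  also have "\<dots> = B * integral S (\<lambda>x. 1)"
    using integral_mult_right[of S B "\<lambda>x. 1"] by simp
  also have "\<dots> = B * measure lebesgue S"
    by (simp add: lmeasure_integral[OF S])
  finally show ?thesis .
next
  \<comment> \<open>A non-integrable function has integral 0 by convention, so the bound persists.
    This lets \<open>theta_corr_bound\<close> estimate the dilatation without an integrability
    proof.\<close>
  case False
  then show ?thesis
    using B by (simp add: not_integrable_integral)
qed

lemma norm_integral_le_disc:
  fixes f :: "real^2 \<Rightarrow> 'b::euclidean_space"
  assumes S: "S \<in> lmeasurable" "S \<subseteq> ball x \<delta>" and "0 \<le> \<delta>"
    and B: "0 \<le> B" "\<And>y. y \<in> S \<Longrightarrow> norm (f y) \<le> B"
  shows "norm (integral S f) \<le> B * (\<delta>\<^sup>2 * pi)"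
proof -
  have "measure lebesgue S \<le> measure lebesgue (ball x \<delta>)"
    using S by (intro measure_mono_fmeasurable) auto
  also have "\<dots> = \<delta>\<^sup>2 * pi"
    using circle_area[OF \<open>0 \<le> \<delta>\<close>, of x] by simp
  finally show ?thesis
    using norm_integral_le_measure[OF S(1) B] B(1) by (meson mult_left_mono order_trans)
qed

lemma integral_ge_disc:
  fixes f :: "real^2 \<Rightarrow> real"
  assumes "ball c r \<subseteq> S" "f integrable_on S" "\<And>y. y \<in> S \<Longrightarrow> 0 \<le> f y"
    and "\<And>y. y \<in> ball c r \<Longrightarrow> B \<le> f y" "0 \<le> r"
  shows "B * (r\<^sup>2 * pi) \<le> integral S f"
proof -
  have const: "(\<lambda>y. B) integrable_on ball c r"
    by (simp add: integrable_on_const)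
  \<comment> \<open>Extension by zero puts both integrals on the whole space, where
    \<open>integral_le\<close> compares them pointwise.\<close>
  have ind: "(\<lambda>y. if y \<in> ball c r then B else 0) integrable_on UNIV"
    using const by (subst integrable_restrict_UNIV)
  have "B * (r\<^sup>2 * pi) = B * integral (ball c r) (\<lambda>x. 1)"
    using circle_area[OF \<open>0 \<le> r\<close>, of c] lmeasure_integral[OF lmeasurable_ball, of c r] by simp
  also have "\<dots> = integral (ball c r) (\<lambda>y. B)"
    using integral_mult_right[of "ball c r" B "\<lambda>x. 1"] by simp
  also have "\<dots> = integral UNIV (\<lambda>y. if y \<in> ball c r then B else 0)"
    by (rule integral_restrict_UNIV[symmetric])
  also have "\<dots> \<le> integral UNIV (\<lambda>y. if y \<in> S then f y else 0)"
    using assms ind by (intro integral_le) (auto simp: integrable_restrict_UNIV)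
  also have "\<dots> = integral S f"
    by (simp add: integral_restrict_UNIV)
  finally show ?thesis .
qed

lemma borel_bounded_integrable_on:
  fixes f :: "'a::euclidean_space \<Rightarrow> 'b::euclidean_space"
  assumes "f \<in> borel_measurable borel" "S \<in> lmeasurable" "\<And>y. y \<in> S \<Longrightarrow> norm (f y) \<le> B"
  shows "f integrable_on S"
proof (rule measurable_bounded_by_integrable_imp_integrable)
  have "f \<in> borel_measurable lebesgue"
    using assms(1) by (intro measurable_completion) simp
  then show "f \<in> borel_measurable (lebesgue_on S)"
    by (rule measurable_restrict_space1)
  show "(\<lambda>x. B) integrable_on S"
    using assms(2) by (rule integrable_on_const)
qed (use assms in auto)

section \<open>The kernel\<close>

lemma Kker_nonneg: "0 \<le> Kker \<delta> r"
  by (simp add: Kker_def)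

lemma Kker_mult_le_1: "0 \<le> r \<Longrightarrow> Kker \<delta> r * r \<le> 1"
  by (simp add: Kker_def)

lemma Kker_ge: "0 < r \<Longrightarrow> r \<le> \<delta> \<Longrightarrow> 1 / \<delta> \<le> Kker \<delta> r"
  by (simp add: Kker_def frac_le)

lemma borel_measurable_Kker [measurable]: "Kker \<delta> \<in> borel_measurable borel"
  unfolding Kker_def by measurable

lemma Kker_square: "0 \<le> r \<Longrightarrow> r \<le> \<delta> \<Longrightarrow> Kker \<delta> r * r\<^sup>2 = r"
  by (auto simp: Kker_def power2_eq_square)

lemma mdelta_eq: "mdelta \<delta> = integral (ball (0::vec2) \<delta>) norm"
  unfolding mdelta_def
  by (intro Henstock_Kurzweil_Integration.integral_cong) (auto intro: Kker_square)

lemma norm_integrable_on_ball: "(norm :: vec2 \<Rightarrow> real) integrable_on ball 0 \<delta>"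
  by (rule borel_bounded_integrable_on[where B=\<delta>]) (auto simp: dist_norm)

lemma mdelta_le:
  assumes "0 \<le> \<delta>" shows "mdelta \<delta> \<le> \<delta> * (\<delta>\<^sup>2 * pi)"
proof -
  have "norm (integral (ball (0::vec2) \<delta>) norm) \<le> \<delta> * (\<delta>\<^sup>2 * pi)"
    using assms by (intro norm_integral_le_disc) (auto simp: dist_norm)
  then show ?thesis
    unfolding mdelta_eq real_norm_def by linarith
qed

text \<open>Only the order \<open>\<delta>^3\<close> matters, so no polar coordinates are used: a
  ball of radius \<open>\<delta>/4\<close> about a point at distance \<open>\<delta>/2\<close> from
  0 lies in the horizon, and the norm is at least \<open>\<delta>/4\<close> on it.\<close>

lemma mdelta_ge:
  assumes "0 \<le> \<delta>" shows "\<delta> ^ 3 * pi / 64 \<le> mdelta \<delta>"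
proof -
  let ?c = "(\<delta>/2) *\<^sub>R axis 1 1 :: vec2"
  have c: "norm ?c = \<delta>/2"
    using assms by simp
  have sub: "y \<in> ball 0 \<delta> \<and> \<delta>/4 \<le> norm y" if "y \<in> ball ?c (\<delta>/4)" for y
  proof -
    have "norm (?c - y) < \<delta>/4"
      using that by (simp add: dist_norm)
    then show ?thesis
      using norm_triangle_ineq3[of ?c y] c by (auto simp: dist_norm)
  qed
  have "\<delta>/4 * ((\<delta>/4)\<^sup>2 * pi) \<le> integral (ball (0::vec2) \<delta>) norm"
    using assms sub norm_integrable_on_ball by (intro integral_ge_disc[where c="?c"]) auto
  then show ?thesis
    by (simp add: mdelta_eq power2_eq_square power3_eq_cube)
qed

lemma mdelta_pos:
  assumes "0 < \<delta>" shows "0 < mdelta \<delta>"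
proof -
  have "0 < \<delta> ^ 3 * pi / 64"
    using assms by simp
  then show ?thesis
    using mdelta_ge[of \<delta>] assms by linarith
qed

section \<open>Uniform interior balls\<close>

text \<open>A finite subcover leaves finitely many parameters, and by \<open>mono\<close> their
  minimum works at every point. The same \<open>e\<close> is neighbourhood radius and parameter of
  \<open>P\<close>, so one minimum suffices.\<close>

lemma compact_uniformize:
  fixes S :: "'a::metric_space set"
  assumes "compact S"
    and mono: "\<And>x e e'. P x e \<Longrightarrow> 0 < e' \<Longrightarrow> e' \<le> e \<Longrightarrow> P x e'"
    and loc: "\<And>b. b \<in> S \<Longrightarrow> \<exists>e>0. \<forall>x\<in>ball b e. P x e"
  shows "\<exists>e>0::real. \<forall>x\<in>S. P x e"
proof -
  obtain e where e: "\<And>b. b \<in> S \<Longrightarrow> 0 < e b" "\<And>b x. b \<in> S \<Longrightarrow> x \<in> ball b (e b) \<Longrightarrow> P x (e b)"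
    using loc by metis
  have "S \<subseteq> (\<Union>b\<in>S. ball b (e b))"
    using e(1) by force
  then obtain F where F: "F \<subseteq> S" "finite F" "S \<subseteq> (\<Union>b\<in>F. ball b (e b))"
    using compactE_image[OF \<open>compact S\<close>, of S "\<lambda>b. ball b (e b)"] by auto
  \<comment> \<open>Inserting 1 keeps the minimum meaningful and positive when \<open>F\<close> is
    empty.\<close>
  define m where "m = Min (insert 1 (e ` F))"
  have "0 < m"
    using F e(1) by (auto simp: m_def)
  moreover have "P x m" if "x \<in> S" for x
  proof -
    obtain b where b: "b \<in> F" "x \<in> ball b (e b)"
      using F \<open>x \<in> S\<close> by blast
    moreover have "m \<le> e b"
      using F b by (auto simp: m_def)
    ultimately show ?thesis
      using e(2)[of b x] F \<open>0 < m\<close> mono by blast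
  qed
  ultimately show ?thesis
    by blast
qed

text \<open>The derivative of \<open>g\<close> is itself differentiable, hence continuous and
  bounded on the compact interval; the mean value inequality turns the bound into a Lipschitz
  constant.\<close>

lemma C3_fun_lipschitz_on_interval:
  assumes "C3_fun g"
  shows "\<exists>L\<ge>0. \<forall>s\<in>{-r..r}. \<forall>t\<in>{-r..r}. \<bar>g s - g t\<bar> \<le> L * \<bar>s - t\<bar>"
proof -
  have d0: "(g has_real_derivative deriv g s) (at s)" for s

  proof -
    have "((deriv ^^ 0) g has_real_derivative (deriv ^^ Suc 0) g s) (at s)"
      using assms unfolding C3_fun_def by (meson zero_less_numeral)
    then show ?thesis by simp
  qed
  have d1: "(deriv g has_real_derivative (deriv ^^ 2) g s) (at s)" for s
  proof -
    have "((deriv ^^ 1) g has_real_derivative (deriv ^^ Suc 1) g s) (at s)"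
      using assms unfolding C3_fun_def by (meson one_less_numeral_iff semiring_norm(77))
    then show ?thesis by (simp add: numeral_2_eq_2)
  qed
  have "continuous_on {-r..r} (deriv g)"
    using d1 by (meson DERIV_continuous continuous_at_imp_continuous_on)
  then have "bounded (deriv g ` {-r..r})"
    by (intro compact_imp_bounded compact_continuous_image) auto
  then obtain L where L: "0 < L" "\<And>s. s \<in> {-r..r} \<Longrightarrow> \<bar>deriv g s\<bar> \<le> L"
    unfolding bounded_pos by auto
  have "norm (g s - g t) \<le> L * norm (s - t)" if "s \<in> {-r..r}" "t \<in> {-r..r}" for s t
    using that L d0
    by (intro field_differentiable_bound[where S="{-r..r}" and f'="deriv g"])
       (auto intro: has_field_derivative_at_within)
  then show ?thesis
    using L(1) by (intro exI[of _ L]) auto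
qed

text \<open>Moving from \<open>x\<close> by \<open>\<delta>/2\<close> straight down from the graph
  gains height \<open>\<delta>/2\<close>. Within \<open>e * \<delta>\<close> of the new centre the
  graph loses at most \<open>L * e * \<delta>\<close> and the point rises by at most
  \<open>e * \<delta>\<close>, so the ball stays below the graph once
  \<open>(1 + L) * e \<le> 1/2\<close>.\<close>

lemma subgraph_interior_ball:
  fixes b :: vec2 and Q :: "real^2^2"
  assumes "0 < r" and Q: "orthogonal_matrix Q" and g: "C3_fun g"
    and \<Omega>: "\<Omega> \<inter> ball b r =
          {y \<in> ball b r. (transpose Q *v (y - b)) $ 2 < g ((transpose Q *v (y - b)) $ 1)}"
  shows "\<exists>e>0. \<forall>x\<in>ball b e \<inter> \<Omega>. \<forall>\<delta>. 0 < \<delta> \<and> \<delta> \<le> e \<longrightarrow> (\<exists>c. ball c (e * \<delta>) \<subseteq> ball x \<delta> \<inter> \<Omega>)"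
proof -
  define A where "A = (\<lambda>v. transpose Q *v v)"
  have A_diff: "A (v - w) = A v - A w" and A_scale: "A (k *\<^sub>R v) = k *\<^sub>R A v" for v w k
    unfolding A_def by (rule matrix_vector_mult_diff_distrib matrix_vector_mult_scaleR)+
  have A_norm: "norm (A v) = norm v" for v
  proof -
    have "A v \<bullet> A v = v \<bullet> (Q *v (transpose Q *v v))"
      unfolding A_def by (metis dot_lmul_matrix transpose_matrix_vector)
    also have "\<dots> = v \<bullet> v"
      using Q unfolding orthogonal_matrix_def by (metis matrix_vector_mul_assoc matrix_vector_mul_lid)
    finally have "A v \<bullet> A v = v \<bullet> v" .
    then show ?thesis by (simp add: norm_eq_sqrt_inner)
  qed
  have A_comp: "\<bar>A v $ i\<bar> \<le> norm v" for v i
    using component_le_norm_cart[of "A v" i] A_norm by simp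
  \<comment> \<open>The upward direction of the chart, pulled back to the original
    coordinates.\<close>
  define w where "w = Q *v axis 2 1"
  have Aw: "A w = axis 2 1"
    using Q unfolding A_def w_def orthogonal_matrix_def
    by (metis matrix_vector_mul_assoc matrix_vector_mul_lid)
  have w: "norm w = 1"
    using A_norm[of w] Aw by simp
  have mem: "y \<in> \<Omega> \<longleftrightarrow> A (y - b) $ 2 < g (A (y - b) $ 1)" if "y \<in> ball b r" for y
    using \<Omega> that unfolding A_def by blast
  obtain L where L: "0 \<le> L" "\<And>s t. s \<in> {-r..r} \<Longrightarrow> t \<in> {-r..r} \<Longrightarrow> \<bar>g s - g t\<bar> \<le> L * \<bar>s - t\<bar>"
    using C3_fun_lipschitz_on_interval[OF g] by meson
  \<comment> \<open>The first term keeps \<open>y\<close> in the chart, since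
    \<open>dist b y < e + \<delta> \<le> 2 * e \<le> r\<close>; the second is the slope condition
    \<open>(1 + L) * e \<le> 1/2\<close>.\<close>
  define e where "e = min (r/2) (1 / (2 * (1 + L)))"
  have "0 < e"
    using \<open>0 < r\<close> L(1) by (auto simp: e_def)
  have "\<exists>c. ball c (e * \<delta>) \<subseteq> ball x \<delta> \<inter> \<Omega>"
    if x: "x \<in> ball b e" "x \<in> \<Omega>" and \<delta>: "0 < \<delta>" "\<delta> \<le> e" for x \<delta>
  proof (intro exI subsetI)
    \<comment> \<open>This fixes the witness for \<open>c\<close>: the point
      \<open>\<delta>/2\<close> below \<open>x\<close>.\<close>
    fix y assume "y \<in> ball (x - (\<delta>/2) *\<^sub>R w) (e * \<delta>)"
    then have v: "norm (y - (x - (\<delta>/2) *\<^sub>R w)) < e * \<delta>"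
      by (simp add: dist_norm norm_minus_commute)
    let ?v = "y - (x - (\<delta>/2) *\<^sub>R w)"
    have e1: "e * (2 * (1 + L)) \<le> 1"
    proof -
      have "e \<le> 1 / (2 * (1 + L))" by (simp add: e_def)
      then show ?thesis using L(1) by (simp add: pos_le_divide_eq)
    qed
    have e2: "e \<le> 1/2"
      using e1 mult_nonneg_nonneg[of e L] \<open>0 < e\<close> L(1) unfolding distrib_left by linarith
    have "e * \<delta> \<le> \<delta>/2"
      using mult_right_mono[OF e2, of \<delta>] \<delta> by simp
    have "norm (y - x) \<le> norm ?v + norm ((\<delta>/2) *\<^sub>R w)"
      using norm_triangle_ineq4[of ?v "(\<delta>/2) *\<^sub>R w"] by simp
    moreover have "norm ((\<delta>/2) *\<^sub>R w) = \<delta>/2"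
      using w \<delta> by simp
    ultimately have yx: "norm (y - x) < \<delta>"
      using v \<open>e * \<delta> \<le> \<delta>/2\<close> by linarith
    have "dist b y \<le> dist b x + dist x y"
      by (rule dist_triangle)
    then have yb: "y \<in> ball b r" and xb: "x \<in> ball b r"
      using yx x \<delta> by (auto simp: e_def dist_norm norm_minus_commute)
    have "A (y - b) = A (x - b) - (\<delta>/2) *\<^sub>R A w + A ?v"
      by (simp add: A_diff A_scale)
    then have A1: "A (y - b) $ 1 = A (x - b) $ 1 + A ?v $ 1"
      and A2: "A (y - b) $ 2 = A (x - b) $ 2 - \<delta>/2 + A ?v $ 2"
      by (simp_all add: Aw axis_def)
    have rng: "A (z - b) $ 1 \<in> {-r..r}" if "z \<in> ball b r" for z
      using A_comp[of "z - b" 1] that by (auto simp: dist_norm norm_minus_commute)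
    have "\<bar>g (A (x - b) $ 1) - g (A (y - b) $ 1)\<bar> \<le> L * \<bar>A ?v $ 1\<bar>"
      using L(2)[OF rng[OF xb] rng[OF yb]] by (simp add: A1)
    also have "\<dots> \<le> L * (e * \<delta>)"
      using A_comp[of ?v 1] v L(1) by (intro mult_left_mono) auto
    finally have "g (A (x - b) $ 1) \<le> g (A (y - b) $ 1) + L * (e * \<delta>)"
      by linarith
    moreover have "A (x - b) $ 2 < g (A (x - b) $ 1)"
      using mem[OF xb] x by simp
    moreover have "A ?v $ 2 \<le> e * \<delta>"
      using A_comp[of ?v 2] v by linarith
    moreover have "L * (e * \<delta>) + e * \<delta> \<le> \<delta>/2"
    proof -
      from mult_right_mono[OF e1, of "\<delta>/2"] \<delta> show ?thesis
        by (simp add: algebra_simps)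
    qed
    ultimately have "A (y - b) $ 2 < g (A (y - b) $ 1)"
      using A2 by linarith
    then show "y \<in> ball x \<delta> \<inter> \<Omega>"
      using mem[OF yb] yx by (auto simp: dist_norm norm_minus_commute)
  qed
  with \<open>0 < e\<close> show ?thesis
    by blast
qed

text \<open>Compactness is applied to the closure of \<open>\<Omega>\<close>. The guard
  \<open>x \<in> \<Omega>\<close> inside \<open>P\<close> lets boundary points serve as centres of
  the cover although they carry no interior ball themselves.\<close>

lemma uniform_interior_balls:
  assumes dom: "bounded_domain \<Omega>" and bdry: "C3_boundary \<Omega>"
  obtains e where "0 < e" "\<And>x \<delta>. x \<in> \<Omega> \<Longrightarrow> 0 < \<delta> \<Longrightarrow> \<delta> \<le> e \<Longrightarrow> \<exists>c. ball c (e * \<delta>) \<subseteq> ball x \<delta> \<inter> \<Omega>"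
proof -
  define P where "P = (\<lambda>x e. x \<in> \<Omega> \<longrightarrow>
    (\<forall>\<delta>. 0 < \<delta> \<and> \<delta> \<le> e \<longrightarrow> (\<exists>c. ball c (e * \<delta>) \<subseteq> ball x \<delta> \<inter> \<Omega>)))"
  have "\<exists>e>0. \<forall>x\<in>closure \<Omega>. P x e"
  proof (rule compact_uniformize)
    show "compact (closure \<Omega>)"
      using dom by (simp add: bounded_domain_def)
  next
    fix x e e' assume P: "P x e" and e': "0 < e'" "e' \<le> (e::real)"
    show "P x e'"
      unfolding P_def
    proof (intro impI allI)
      fix \<delta> assume "x \<in> \<Omega>" and \<delta>: "0 < \<delta> \<and> \<delta> \<le> e'"
      then obtain c where "ball c (e * \<delta>) \<subseteq> ball x \<delta> \<inter> \<Omega>"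
        using P e' unfolding P_def by force
      moreover have "ball c (e' * \<delta>) \<subseteq> ball c (e * \<delta>)"
        using \<delta> e' by (intro subset_ball mult_right_mono) auto
      ultimately show "\<exists>c. ball c (e' * \<delta>) \<subseteq> ball x \<delta> \<inter> \<Omega>"
        by blast
    qed
  next
    fix b assume b: "b \<in> closure \<Omega>"
    show "\<exists>e>0. \<forall>x\<in>ball b e. P x e"
    proof (cases "b \<in> \<Omega>")
      case True
      then obtain r where r: "0 < r" "ball b r \<subseteq> \<Omega>"
        using dom unfolding bounded_domain_def by (meson open_contains_ball)
      \<comment> \<open>The bound 1 puts \<open>ball x (e * \<delta>)\<close> inside
        \<open>ball x \<delta>\<close>; the bound \<open>r/2\<close> keeps
        \<open>ball x \<delta>\<close> inside \<open>ball b r\<close>.\<close>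
      define e where "e = min 1 (r/2)"
      have "ball x (e * \<delta>) \<subseteq> ball x \<delta> \<inter> \<Omega>" if x: "x \<in> ball b e" and \<delta>: "0 < \<delta>" "\<delta> \<le> e" for x \<delta>
      proof -
        have "e * \<delta> \<le> 1 * \<delta>"
          using \<delta> by (intro mult_right_mono) (auto simp: e_def)
        then have "ball x (e * \<delta>) \<subseteq> ball x \<delta>"
          by (intro subset_ball) simp
        moreover have "ball x \<delta> \<subseteq> ball b r"
        proof
          fix y assume "y \<in> ball x \<delta>"
          then show "y \<in> ball b r"
            using x \<delta> dist_triangle[of b y x] by (auto simp: e_def)
        qed
        ultimately show ?thesis
          using r by blast
      qed
      moreover have "0 < e"
        using r by (simp add: e_def)
      ultimately show ?thesis
        unfolding P_def by blast
    next
      case False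
      then have "b \<in> frontier \<Omega>"
        using b dom by (simp add: frontier_def bounded_domain_def interior_open)
      then obtain r Q g where "0 < r" "orthogonal_matrix Q" "C3_fun g" "\<Omega> \<inter> ball b r =
          {y \<in> ball b r. (transpose Q *v (y - b)) $ 2 < g ((transpose Q *v (y - b)) $ 1)}"
        using bdry unfolding C3_boundary_def by blast
      from subgraph_interior_ball[OF this] show ?thesis
        unfolding P_def by blast
    qed
  qed
  then show ?thesis
    using that closure_subset unfolding P_def by blast
qed

section \<open>Bounds on the derivative\<close>

text \<open>Continuity is given for each fixed direction only, so the derivative is bounded on the
  finitely many basis vectors and extended to all \<open>v\<close> by linearity.\<close>

lemma frechet_derivative_bounded_on_compact:
  fixes u :: "'a::euclidean_space \<Rightarrow> 'b::euclidean_space"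
  assumes "compact K" "\<And>x. x \<in> K \<Longrightarrow> u differentiable (at x)"
    and cont: "\<And>v. continuous_on K (\<lambda>x. frechet_derivative u (at x) v)"
  obtains L where "0 \<le> L" "\<And>x v. x \<in> K \<Longrightarrow> norm (frechet_derivative u (at x) v) \<le> L * norm v"
proof -
  have "bounded ((\<lambda>x. frechet_derivative u (at x) i) ` K)" for i
    using assms by (intro compact_imp_bounded compact_continuous_image) auto
  then have "\<forall>i. \<exists>B\<ge>0. \<forall>x\<in>K. norm (frechet_derivative u (at x) i) \<le> B"
    unfolding bounded_pos by (meson imageI less_imp_le)
  then obtain B where B: "\<And>i. 0 \<le> B i" "\<And>i x. x \<in> K \<Longrightarrow> norm (frechet_derivative u (at x) i) \<le> B i"
    by metis
  have "norm (frechet_derivative u (at x) v) \<le> (\<Sum>i\<in>Basis. B i) * norm v" if "x \<in> K" for x v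
  proof -
    have lin: "linear (frechet_derivative u (at x))"
      using assms(2)[OF that] by (rule linear_frechet_derivative)
    have "frechet_derivative u (at x) v = frechet_derivative u (at x) (\<Sum>i\<in>Basis. (v \<bullet> i) *\<^sub>R i)"
      by (simp add: euclidean_representation)
    also have "\<dots> = (\<Sum>i\<in>Basis. (v \<bullet> i) *\<^sub>R frechet_derivative u (at x) i)"
      by (simp add: linear_sum[OF lin] linear_scale[OF lin])
    also have "norm \<dots> \<le> (\<Sum>i\<in>Basis. B i * norm v)"
    proof (intro sum_norm_le)
      fix i :: 'a assume "i \<in> Basis"
      then have "\<bar>v \<bullet> i\<bar> \<le> norm v"
        by (rule Basis_le_norm)
      then have "\<bar>v \<bullet> i\<bar> * norm (frechet_derivative u (at x) i) \<le> norm v * B i"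
        using B that by (intro mult_mono) auto
      then show "norm ((v \<bullet> i) *\<^sub>R frechet_derivative u (at x) i) \<le> B i * norm v"
        by (simp add: mult.commute)
    qed
    finally show ?thesis
      by (simp add: sum_distrib_right)
  qed
  moreover have "0 \<le> (\<Sum>i\<in>Basis. B i)"
    using B by (simp add: sum_nonneg)
  ultimately show ?thesis
    using that by blast
qed

text \<open>\<open>S\<close> need not be convex, so the mean value inequality is used on the ball of
  radius \<open>r\<close> about each point. The union of the closed balls is still compact and
  inside \<open>U\<close>, which makes \<open>L\<close> uniform.\<close>

lemma C1_near_compact_bounds:
  fixes u :: "'a::euclidean_space \<Rightarrow> 'b::euclidean_space"
  assumes "compact S" "open U" "S \<subseteq> U" and diff: "\<And>x. x \<in> U \<Longrightarrow> u differentiable (at x)"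
    and cont: "\<And>v. continuous_on U (\<lambda>x. frechet_derivative u (at x) v)"
  obtains L r where "0 \<le> L" "0 < r"
    "\<And>x v. x \<in> S \<Longrightarrow> norm (frechet_derivative u (at x) v) \<le> L * norm v"
    "\<And>x y. x \<in> S \<Longrightarrow> dist x y < r \<Longrightarrow> norm (u y - u x) \<le> L * norm (y - x)"
proof -
  obtain r where r: "0 < r" "(\<Union>x\<in>S. cball x r) \<subseteq> U"
    using compact_subset_open_imp_cball_epsilon_subset[OF assms(1-3)] by blast
  let ?K = "\<Union>x\<in>S. cball x r"
  have "compact ?K"
    using \<open>compact S\<close> by (rule compact_minkowski_sum_cball)
  then obtain L where L: "0 \<le> L"
      "\<And>x v. x \<in> ?K \<Longrightarrow> norm (frechet_derivative u (at x) v) \<le> L * norm v"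
    using frechet_derivative_bounded_on_compact[OF _ diff[OF subsetD[OF r(2)]]
        continuous_on_subset[OF cont r(2)]] by blast
  have "norm (u y - u x) \<le> L * norm (y - x)" if x: "x \<in> S" and y: "dist x y < r" for x y
  proof (rule differentiable_bound)
    show "convex (ball x r)" "x \<in> ball x r" "y \<in> ball x r"
      using r y by auto
  next
    fix w assume "w \<in> ball x r"
    then have w: "w \<in> ?K"
      using x by force
    show "(u has_derivative frechet_derivative u (at w)) (at w within ball x r)"
      using frechet_derivative_works[THEN iffD1, OF diff[OF subsetD[OF r(2) w]]]
      by (rule has_derivative_at_withinI)
    show "onorm (frechet_derivative u (at w)) \<le> L"
      using L(2)[OF w] by (rule onorm_le)
  qed
  moreover have "S \<subseteq> ?K"
    using r(1) by force
  ultimately show ?thesis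
    using that[OF L(1) r(1)] L(2) by (meson subsetD)
qed

section \<open>The dilatation\<close>

lemma outer2_mult_vec: "outer2 a b *v v = (b \<bullet> v) *\<^sub>R a"
  by (simp add: vec_eq_iff outer2_def matrix_vector_mult_def inner_vec_def sum_distrib_left mult_ac)

lemma norm_outer2: "norm (outer2 a b) = norm a * norm b"
proof -
  have "norm (outer2 a b $ i) = norm b * norm (a $ i)" for i
  proof -
    have "outer2 a b $ i = (a $ i) *\<^sub>R b"
      by (simp add: outer2_def vec_eq_iff)
    then show ?thesis
      by simp
  qed
  then have "norm (outer2 a b) = L2_set (\<lambda>i. norm b * norm (a $ i)) UNIV"
    by (simp add: norm_vec_def[of "outer2 a b"])
  also have "\<dots> = norm b * norm a"
    by (simp add: norm_vec_def[of a] L2_set_right_distrib)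
  finally show ?thesis
    by simp
qed

text \<open>By Cauchy-Schwarz, coercivity gives \<open>c * norm v \<le> norm (A *v v)\<close>. This
  yields injectivity, so that \<open>matrix_inv\<close> is a true inverse and not an arbitrary
  choice, and then the bound on taking \<open>v\<close> to be the inverse image of
  \<open>w\<close>.\<close>

lemma coercive_matrix_inv_bound:
  fixes A :: "real^'n^'n"
  assumes "0 < c" and coer: "\<And>v. c * (norm v)\<^sup>2 \<le> v \<bullet> (A *v v)"
  shows "norm (matrix_inv A *v w) \<le> norm w / c"
proof -
  have lower: "c * norm v \<le> norm (A *v v)" for v
  proof (cases "v = 0")
    case False
    have "norm v * (c * norm v) \<le> norm v * norm (A *v v)"
      using coer[of v] norm_cauchy_schwarz[of v "A *v v"] by (simp add: power2_eq_square algebra_simps)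
    then show ?thesis
      using False by simp
  qed simp
  have "v = w" if "A *v v = A *v w" for v w
  proof -
    have "c * norm (v - w) \<le> 0"
      using lower[of "v - w"] that by (simp add: matrix_vector_mult_diff_distrib)
    then show ?thesis
      using \<open>0 < c\<close> by (simp add: mult_le_0_iff)
  qed
  then have "inj ((*v) A)"
    by (intro injI)
  then have "invertible A"
    by (simp add: invertible_left_inverse matrix_left_invertible_injective)
  then have "A ** matrix_inv A = mat 1"
    unfolding invertible_def matrix_inv_def by (rule someI2_ex) blast
  then have "A *v (matrix_inv A *v w) = w"
    by (simp add: matrix_vector_mul_assoc)
  then have "c * norm (matrix_inv A *v w) \<le> norm w"
    using lower[of "matrix_inv A *v w"] by simp
  then show ?thesis
    using \<open>0 < c\<close> by (simp add: field_simps)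
qed

text \<open>The centre is shifted along \<open>v\<close>, away from the line through \<open>x\<close> orthogonal to \<open>v\<close>.\<close>
lemma ball_contains_ball_off_line:
  fixes c x v :: "'a::real_inner"
  assumes "norm v = 1"
  obtains c' where "ball c' (r/4) \<subseteq> ball c r" "\<And>y. y \<in> ball c' (r/4) \<Longrightarrow> r/4 \<le> \<bar>(y - x) \<bullet> v\<bar>"
proof -
  define s :: real where "s = (if 0 \<le> (c - x) \<bullet> v then 1 else -1)"
  define c' where "c' = c + (s * (r/2)) *\<^sub>R v"
  have vv: "v \<bullet> v = 1"
    using assms by (simp add: norm_eq_1)
  have "(c' - x) \<bullet> v = (c - x) \<bullet> v + s * (r/2)"
    by (simp add: c'_def vv algebra_simps)
  then have c': "0 \<le> (c - x) \<bullet> v \<and> (c' - x) \<bullet> v = (c - x) \<bullet> v + r/2 \<or>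
      (c - x) \<bullet> v < 0 \<and> (c' - x) \<bullet> v = (c - x) \<bullet> v - r/2"
    by (simp add: s_def split: if_splits)
  show ?thesis
  proof
    show "ball c' (r/4) \<subseteq> ball c r"
    proof
      fix y assume y: "y \<in> ball c' (r/4)"
      then have "0 < r"
        using zero_le_dist[of c' y] unfolding mem_ball by linarith
      moreover have "dist c c' = \<bar>r\<bar>/2"
        using assms by (simp add: c'_def dist_norm s_def)
      ultimately show "y \<in> ball c r"
        using y dist_triangle[of c y c'] by simp
    qed
  next
    fix y assume "y \<in> ball c' (r/4)"
    then have "\<bar>(y - c') \<bullet> v\<bar> < r/4"
      using Cauchy_Schwarz_ineq2[of "y - c'" v] assms by (simp add: dist_norm norm_minus_commute)
    moreover have "(y - x) \<bullet> v = (y - c') \<bullet> v + (c' - x) \<bullet> v"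
      by (simp add: algebra_simps)
    ultimately show "r/4 \<le> \<bar>(y - x) \<bullet> v\<bar>"
      using c' by linarith
  qed
qed

text \<open>The quadratic form is the integral of the nonnegative function
  \<open>K(|z|) (z \<bullet> v)^2\<close>, so it may be restricted to a ball of radius
  \<open>e * \<delta>/4\<close> that avoids the line \<open>z \<bullet> v = 0\<close>. For unit
  \<open>v\<close> this gives at least \<open>e^4 * \<delta>^3 * pi / 256\<close>; the bound
  \<open>mdelta \<delta> \<le> \<delta>^3 * pi\<close> and the factor \<open>dimd = 2\<close> turn
  it into \<open>e^4 / 128\<close>, free of \<open>\<delta>\<close>.\<close>

lemma shape_matrix_coercive:
  fixes x :: vec2
  assumes \<delta>: "0 < \<delta>" and e: "0 < e" "ball c (e * \<delta>) \<subseteq> S" "S \<subseteq> ball x \<delta>" and S: "S \<in> lmeasurable"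
  defines "A \<equiv> (dimd / mdelta \<delta>) *\<^sub>R
      integral S (\<lambda>y. Kker \<delta> (norm (y - x)) *\<^sub>R outer2 (y - x) (y - x))"
  shows "e ^ 4 / 128 * (norm v)\<^sup>2 \<le> v \<bullet> (A *v v)"
proof -
  let ?F = "\<lambda>y. Kker \<delta> (norm (y - x)) *\<^sub>R outer2 (y - x) (y - x)"
  let ?q = "\<lambda>v y. Kker \<delta> (norm (y - x)) * ((y - x) \<bullet> v)\<^sup>2"
  have int: "?F integrable_on S"
  proof (rule borel_bounded_integrable_on[OF _ S])
    have "continuous_on UNIV (\<lambda>y. outer2 (y - x) (y - x))"
      unfolding outer2_def by (intro continuous_intros)
    then have [measurable]: "(\<lambda>y. outer2 (y - x) (y - x)) \<in> borel_measurable borel"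
      by (rule borel_measurable_continuous_onI)
    show "?F \<in> borel_measurable borel"
      by measurable
  next
    fix y assume "y \<in> S"
    then have y: "norm (y - x) \<le> \<delta>"
      using e by (force simp: dist_norm norm_minus_commute)
    then have "norm (?F y) = norm (y - x)"
      using Kker_square[of "norm (y - x)" \<delta>] by (simp add: norm_outer2 Kker_nonneg power2_eq_square)
    then show "norm (?F y) \<le> \<delta>"
      using y by simp
  qed
  have quad: "?q v integrable_on S \<and> v \<bullet> (integral S ?F *v v) = integral S (?q v)" for v
  proof -
    \<comment> \<open>The quadratic form is linear in the matrix, so it passes under the
      integral.\<close>
    have bl: "bounded_linear (\<lambda>B::real^2^2. v \<bullet> (B *v v))"
      by (intro linear_conv_bounded_linear[THEN iffD1] linearI)
         (simp_all add: matrix_vector_mult_add_rdistrib inner_add_right scaleR_matrix_vector_assoc[symmetric])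
    have eq: "(\<lambda>B::real^2^2. v \<bullet> (B *v v)) \<circ> ?F = ?q v"
      by (auto simp: fun_eq_iff outer2_mult_vec scaleR_matrix_vector_assoc[symmetric]
          power2_eq_square inner_commute)
    show ?thesis
      using integral_linear[OF int bl] integrable_linear[OF int bl] unfolding eq by simp
  qed
  have m: "0 < mdelta \<delta>"
    using \<delta> by (rule mdelta_pos)
  have unit: "e ^ 4 / 128 \<le> w \<bullet> (A *v w)" if w: "norm w = 1" for w
  proof -
    obtain c' where c': "ball c' (e * \<delta>/4) \<subseteq> ball c (e * \<delta>)"
      "\<And>y. y \<in> ball c' (e * \<delta>/4) \<Longrightarrow> e * \<delta>/4 \<le> \<bar>(y - x) \<bullet> w\<bar>"
      using ball_contains_ball_off_line[OF w, of "e * \<delta>" c x] by blast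
    have "1 / \<delta> * (e * \<delta>/4)\<^sup>2 * ((e * \<delta>/4)\<^sup>2 * pi) \<le> integral S (?q w)"
    proof (rule integral_ge_disc)
      show "ball c' (e * \<delta>/4) \<subseteq> S"
        using c' e by blast
      fix y assume y: "y \<in> ball c' (e * \<delta>/4)"
      then have "e * \<delta>/4 \<le> \<bar>(y - x) \<bullet> w\<bar>"
        by (rule c')
      \<comment> \<open>Positivity excludes \<open>y = x\<close>, where the kernel is set to 0 and
        its lower bound fails.\<close>
      moreover have "0 < e * \<delta>/4"
        using \<delta> e by simp
      moreover have "\<bar>(y - x) \<bullet> w\<bar> \<le> norm (y - x)"
        using Cauchy_Schwarz_ineq2[of "y - x" w] w by simp
      moreover have "norm (y - x) \<le> \<delta>"
        using y c' e by (force simp: dist_norm norm_minus_commute)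
      ultimately have "1 / \<delta> \<le> Kker \<delta> (norm (y - x))" "(e * \<delta>/4)\<^sup>2 \<le> ((y - x) \<bullet> w)\<^sup>2"
        by (auto intro!: Kker_ge simp: abs_le_square_iff[symmetric])
      then show "1 / \<delta> * (e * \<delta>/4)\<^sup>2 \<le> ?q w y"
        by (intro mult_mono) (auto simp: Kker_nonneg)
    qed (use quad \<delta> e in \<open>auto simp: Kker_nonneg\<close>)
    moreover have "1 / \<delta> * (e * \<delta>/4)\<^sup>2 * ((e * \<delta>/4)\<^sup>2 * pi) = e ^ 4 / 256 * (\<delta> * (\<delta>\<^sup>2 * pi))"
      using \<delta> by (simp add: field_simps power2_eq_square power4_eq_xxxx)
    moreover have "e ^ 4 / 256 * mdelta \<delta> \<le> e ^ 4 / 256 * (\<delta> * (\<delta>\<^sup>2 * pi))"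
      using mdelta_le[of \<delta>] \<delta> by (intro mult_left_mono) auto
    ultimately have "e ^ 4 / 256 * mdelta \<delta> \<le> integral S (?q w)"
      by linarith
    then have "e ^ 4 / 128 \<le> 2 / mdelta \<delta> * integral S (?q w)"
      using m by (simp add: field_simps)
    also have "\<dots> = w \<bullet> (A *v w)"
      using quad[of w] by (simp add: A_def dimd_def scaleR_matrix_vector_assoc[symmetric])
    finally show ?thesis .
  qed
  show ?thesis
  proof (cases "v = 0")
    case False
    have "e ^ 4 / 128 \<le> sgn v \<bullet> (A *v sgn v)"
      using False by (intro unit) (simp add: norm_sgn)
    also have "\<dots> = v \<bullet> (A *v v) / (norm v)\<^sup>2"
      by (simp add: sgn_div_norm matrix_vector_mult_scaleR power2_eq_square divide_simps)
    finally show ?thesis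
      using False by (simp add: field_simps)
  qed simp
qed

text \<open>The integrand is at most \<open>L * \<delta> * 128 / e^4\<close>, since
  \<open>K(r) r \<le> 1\<close> and the inverse shape matrix has norm at most
  \<open>128 / e^4\<close>. The disc area makes the integral \<open>O(\<delta>^3)\<close>, which
  cancels against \<open>mdelta \<delta>\<close>; the outer 128 is \<open>dimd\<close> times 64 from
  \<open>mdelta_ge\<close>.\<close>

lemma theta_corr_bound:
  assumes \<delta>: "0 < \<delta>" and e: "0 < e" "ball c (e * \<delta>) \<subseteq> ball x \<delta> \<inter> \<Omega>" and "open \<Omega>" and "0 \<le> L"
    and lip: "\<And>y. dist x y < \<delta> \<Longrightarrow> norm (u y - u x) \<le> L * norm (y - x)"
  shows "\<bar>theta_corr \<delta> \<Omega> u x\<bar> \<le> 128 * (L * 128 / e ^ 4)"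
proof -
  let ?S = "ball x \<delta> \<inter> \<Omega>"
  have S: "?S \<in> lmeasurable"
    using \<open>open \<Omega>\<close> by (intro lmeasurable_open) (auto simp: open_Int bounded_Int)
  define R where "R = L * 128 / e ^ 4"
  have "0 \<le> R"
    using \<open>0 \<le> L\<close> e by (simp add: R_def)
  have m: "\<delta> ^ 3 * pi / 64 \<le> mdelta \<delta>" "0 < \<delta> ^ 3 * pi / 64" "0 < mdelta \<delta>"
    using mdelta_ge[of \<delta>] mdelta_pos[OF \<delta>] \<delta> by auto
  let ?I = "integral ?S (\<lambda>y. Kker \<delta> (norm (y - x)) * ((y - x) \<bullet> (Mmat \<delta> \<Omega> x *v (u y - u x))))"
  have "norm ?I \<le> (\<delta> * R) * (\<delta>\<^sup>2 * pi)"
  proof (rule norm_integral_le_disc[OF S])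
    fix y assume y: "y \<in> ?S"
    have "norm (Mmat \<delta> \<Omega> x *v (u y - u x)) \<le> norm (u y - u x) / (e ^ 4 / 128)"
      unfolding Mmat_def
      using e by (intro coercive_matrix_inv_bound shape_matrix_coercive[OF \<delta> e(1,2) _ S]) auto
    also have "\<dots> \<le> (L * norm (y - x)) / (e ^ 4 / 128)"
      using lip y e by (intro divide_right_mono) auto
    also have "\<dots> = R * norm (y - x)"
      by (simp add: R_def)
    also have "\<dots> \<le> R * \<delta>"
      using y \<open>0 \<le> R\<close> by (intro mult_left_mono) (auto simp: dist_norm norm_minus_commute)
    finally have M: "norm (Mmat \<delta> \<Omega> x *v (u y - u x)) \<le> R * \<delta>" .
    have "norm (Kker \<delta> (norm (y - x)) * ((y - x) \<bullet> (Mmat \<delta> \<Omega> x *v (u y - u x))))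
      \<le> Kker \<delta> (norm (y - x)) * (norm (y - x) * norm (Mmat \<delta> \<Omega> x *v (u y - u x)))"
      by (auto simp: abs_mult Kker_nonneg intro!: mult_left_mono Cauchy_Schwarz_ineq2)
    also have "\<dots> = (Kker \<delta> (norm (y - x)) * norm (y - x)) * norm (Mmat \<delta> \<Omega> x *v (u y - u x))"
      by simp
    also have "\<dots> \<le> 1 * (R * \<delta>)"
      using M by (intro mult_mono Kker_mult_le_1) (auto simp: Kker_nonneg)
    finally show "norm (Kker \<delta> (norm (y - x)) * ((y - x) \<bullet> (Mmat \<delta> \<Omega> x *v (u y - u x)))) \<le> \<delta> * R"
      by (simp add: mult.commute)
  qed (use \<delta> \<open>0 \<le> R\<close> in auto)
  then have "2 / mdelta \<delta> * \<bar>?I\<bar> \<le> 2 / mdelta \<delta> * ((\<delta> * R) * (\<delta>\<^sup>2 * pi))"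
    using m by (intro mult_left_mono) auto
  then have "\<bar>theta_corr \<delta> \<Omega> u x\<bar> \<le> 2 / mdelta \<delta> * ((\<delta> * R) * (\<delta>\<^sup>2 * pi))"
    using m unfolding theta_corr_def dimd_def by (simp only: abs_mult) simp
  also have "\<dots> \<le> 2 / (\<delta> ^ 3 * pi / 64) * ((\<delta> * R) * (\<delta>\<^sup>2 * pi))"
    using m \<delta> \<open>0 \<le> R\<close> by (intro mult_right_mono divide_left_mono mult_pos_pos) auto
  also have "\<dots> = 128 * R"
    using \<delta> by (simp add: field_simps power2_eq_square power3_eq_cube)
  finally show ?thesis
    by (simp add: R_def)
qed

section \<open>The exterior integrals\<close>

text \<open>The exterior integrals only use the arguments \<open>n, p, p\<close> and
  \<open>n, n, n\<close>. Three separate slots make the expression trilinear, so that one vector can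
  be exchanged at a time.\<close>

definition cubic_moment :: "real \<Rightarrow> vec2 set \<Rightarrow> vec2 \<Rightarrow> vec2 \<Rightarrow> vec2 \<Rightarrow> vec2 \<Rightarrow> real" where
  "cubic_moment \<delta> S x a b c = integral S (\<lambda>y. Kker \<delta> (norm (y - x)) *
     ((y - x) \<bullet> a) * ((y - x) \<bullet> b) * ((y - x) \<bullet> c) / (norm (y - x))\<^sup>2)"

text \<open>Three factors \<open>|z|\<close> over \<open>|z|^2\<close> leave one, which the kernel
  absorbs through \<open>K(r) r \<le> 1\<close>.\<close>

lemma cubic_moment_integrand_bound:
  fixes z a b c :: vec2
  shows "\<bar>Kker \<delta> (norm z) * (z \<bullet> a) * (z \<bullet> b) * (z \<bullet> c) / (norm z)\<^sup>2\<bar> \<le> norm a * norm b * norm c"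
proof (cases "z = 0")
  case False
  have "\<bar>z \<bullet> a\<bar> * \<bar>z \<bullet> b\<bar> * \<bar>z \<bullet> c\<bar> \<le> (norm z * norm a) * (norm z * norm b) * (norm z * norm c)"
    by (intro mult_mono Cauchy_Schwarz_ineq2) auto
  then have "Kker \<delta> (norm z) * (\<bar>z \<bullet> a\<bar> * \<bar>z \<bullet> b\<bar> * \<bar>z \<bullet> c\<bar>)
      \<le> Kker \<delta> (norm z) * ((norm z * norm a) * (norm z * norm b) * (norm z * norm c))"
    by (intro mult_left_mono) (auto simp: Kker_nonneg)
  also have "\<dots> = (Kker \<delta> (norm z) * norm z) * (norm a * norm b * norm c * (norm z)\<^sup>2)"
    by (simp add: power2_eq_square)
  also have "\<dots> \<le> 1 * (norm a * norm b * norm c * (norm z)\<^sup>2)"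
    by (intro mult_right_mono Kker_mult_le_1) auto
  finally show ?thesis
    using False by (simp add: abs_mult Kker_nonneg field_simps)
qed simp

lemma cubic_moment_integrable:
  fixes x a b c :: vec2
  assumes "S \<in> lmeasurable"
  shows "(\<lambda>y. Kker \<delta> (norm (y - x)) *
     ((y - x) \<bullet> a) * ((y - x) \<bullet> b) * ((y - x) \<bullet> c) / (norm (y - x))\<^sup>2) integrable_on S"
proof (rule borel_bounded_integrable_on[OF _ assms])
  show "(\<lambda>y. Kker \<delta> (norm (y - x)) *
     ((y - x) \<bullet> a) * ((y - x) \<bullet> b) * ((y - x) \<bullet> c) / (norm (y - x))\<^sup>2) \<in> borel_measurable borel"
    by measurable
  show "norm (Kker \<delta> (norm (y - x)) *
     ((y - x) \<bullet> a) * ((y - x) \<bullet> b) * ((y - x) \<bullet> c) / (norm (y - x))\<^sup>2) \<le> norm a * norm b * norm c" for y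
    using cubic_moment_integrand_bound by simp
qed

lemma cubic_moment_bound:
  assumes "S \<in> lmeasurable" "S \<subseteq> ball x \<delta>" "0 \<le> \<delta>"
  shows "\<bar>cubic_moment \<delta> S x a b c\<bar> \<le> norm a * norm b * norm c * (\<delta>\<^sup>2 * pi)"
proof -
  have "norm (cubic_moment \<delta> S x a b c) \<le> norm a * norm b * norm c * (\<delta>\<^sup>2 * pi)"
    unfolding cubic_moment_def using cubic_moment_integrand_bound
    by (intro norm_integral_le_disc[OF assms]) simp_all
  then show ?thesis
    by simp
qed

lemma cubic_moment_diff:
  assumes "S \<in> lmeasurable"
  shows "cubic_moment \<delta> S x (a - a') b c = cubic_moment \<delta> S x a b c - cubic_moment \<delta> S x a' b c"
proof -
  have "k * (z \<bullet> (a - a')) * s * t / N = k * (z \<bullet> a) * s * t / N - k * (z \<bullet> a') * s * t / N" for k s t N z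
    by (simp add: inner_diff_right left_diff_distrib right_diff_distrib diff_divide_distrib)
  then show ?thesis
    unfolding cubic_moment_def
    by (simp only: integral_diff[OF cubic_moment_integrable[OF assms] cubic_moment_integrable[OF assms]])
qed

text \<open>With the next lemma, this carries linearity in the first slot over to the other
  two.\<close>

lemma cubic_moment_swap12: "cubic_moment \<delta> S x a b c = cubic_moment \<delta> S x b a c"
  by (simp add: cubic_moment_def mult_ac)

lemma cubic_moment_swap13: "cubic_moment \<delta> S x a b c = cubic_moment \<delta> S x c b a"
  by (simp add: cubic_moment_def mult_ac)

text \<open>The difference telescopes into three terms, one vector changing in each. Symmetry moves
  the changed vector to the first slot, where \<open>cubic_moment_diff\<close> applies.\<close>

lemma cubic_moment_perturbation:
  assumes S: "S \<in> lmeasurable" "S \<subseteq> ball x \<delta>" "0 \<le> \<delta>"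
    and "norm a \<le> B" "norm b \<le> B" "norm c \<le> B" "norm a' \<le> B" "norm b' \<le> B" "norm c' \<le> B"
    and "norm (a - a') \<le> \<epsilon>" "norm (b - b') \<le> \<epsilon>" "norm (c - c') \<le> \<epsilon>"
  shows "\<bar>cubic_moment \<delta> S x a b c - cubic_moment \<delta> S x a' b' c'\<bar> \<le> 3 * \<epsilon> * B\<^sup>2 * (\<delta>\<^sup>2 * pi)"
proof -
  let ?G = "cubic_moment \<delta> S x"
  have "0 \<le> B" "0 \<le> \<epsilon>"
    using assms norm_ge_zero order_trans by blast+
  have bd: "\<bar>?G v w w'\<bar> \<le> \<epsilon> * B * B * (\<delta>\<^sup>2 * pi)" if "norm v \<le> \<epsilon>" "norm w \<le> B" "norm w' \<le> B" for v w w'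
  proof -
    have "norm v * norm w * norm w' * (\<delta>\<^sup>2 * pi) \<le> \<epsilon> * B * B * (\<delta>\<^sup>2 * pi)"
      using that \<open>0 \<le> B\<close> \<open>0 \<le> \<epsilon>\<close> by (intro mult_right_mono mult_mono) auto
    then show ?thesis
      using cubic_moment_bound[OF S, of v w w'] by linarith
  qed
  have "?G a b c - ?G a' b' c' = (?G a b c - ?G a' b c) + (?G b a' c - ?G b' a' c) + (?G c b' a' - ?G c' b' a')"
    using cubic_moment_swap12[of \<delta> S x a' b c] cubic_moment_swap12[of \<delta> S x a' b' c]
      cubic_moment_swap13[of \<delta> S x a' b' c] cubic_moment_swap13[of \<delta> S x a' b' c'] by linarith
  also have "\<dots> = ?G (a - a') b c + ?G (b - b') a' c + ?G (c - c') b' a'"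
    by (simp add: cubic_moment_diff[OF S(1)])
  finally have "\<bar>?G a b c - ?G a' b' c'\<bar> \<le> 3 * (\<epsilon> * B * B * (\<delta>\<^sup>2 * pi))"
    using bd[of "a - a'" b c] bd[of "b - b'" a' c] bd[of "c - c'" b' a'] assms by linarith
  then show ?thesis
    by (simp add: power2_eq_square algebra_simps)
qed

text \<open>A product of five factors telescopes: three changes inside the moment, one in the weight
  \<open>T\<close>, one in the direction \<open>w\<close>. Hence the constant 5, with the other four
  factors bounded by \<open>B\<close>.\<close>

lemma weighted_cubic_moment_perturbation:
  assumes S: "S \<in> lmeasurable" "S \<subseteq> ball x \<delta>" "0 \<le> \<delta>"
    and B: "norm a \<le> B" "norm b \<le> B" "norm c \<le> B" "norm a' \<le> B" "norm b' \<le> B" "norm c' \<le> B"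
    and \<epsilon>: "norm (a - a') \<le> \<epsilon>" "norm (b - b') \<le> \<epsilon>" "norm (c - c') \<le> \<epsilon>"
    and T: "\<bar>T\<bar> \<le> B" "\<bar>T'\<bar> \<le> B" "\<bar>T - T'\<bar> \<le> \<epsilon>"
    and w: "norm w \<le> B" "norm w' \<le> B" "norm (w - w') \<le> \<epsilon>"
  shows "norm ((cubic_moment \<delta> S x a b c * T) *\<^sub>R w - (cubic_moment \<delta> S x a' b' c' * T') *\<^sub>R w')
    \<le> 5 * \<epsilon> * B ^ 4 * (\<delta>\<^sup>2 * pi)"
proof -
  let ?G = "cubic_moment \<delta> S x a b c" and ?G' = "cubic_moment \<delta> S x a' b' c'" and ?V = "\<delta>\<^sup>2 * pi"
  have nn: "0 \<le> B" "0 \<le> \<epsilon>" "0 \<le> ?V"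
    using B \<epsilon> norm_ge_zero order_trans by (blast, blast) simp
  have G': "\<bar>?G'\<bar> \<le> B * B * B * ?V"
  proof -
    have "norm a' * norm b' * norm c' * ?V \<le> B * B * B * ?V"
      using B nn by (intro mult_right_mono mult_mono) auto
    then show ?thesis
      using cubic_moment_bound[OF S, of a' b' c'] by linarith
  qed
  have dG: "\<bar>?G - ?G'\<bar> \<le> 3 * \<epsilon> * B\<^sup>2 * ?V"
    using cubic_moment_perturbation[OF S B \<epsilon>] .
  have "(?G * T) *\<^sub>R w - (?G' * T') *\<^sub>R w'
      = ((?G - ?G') * T) *\<^sub>R w + (?G' * (T - T')) *\<^sub>R w + (?G' * T') *\<^sub>R (w - w')"
    by (simp add: algebra_simps)
  also have "norm \<dots> \<le> \<bar>?G - ?G'\<bar> * \<bar>T\<bar> * norm w + \<bar>?G'\<bar> * \<bar>T - T'\<bar> * norm w + \<bar>?G'\<bar> * \<bar>T'\<bar> * norm (w - w')"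
    by (intro order.trans[OF norm_triangle_ineq] add_mono) (simp_all add: abs_mult)
  also have "\<dots> \<le> (3 * \<epsilon> * B\<^sup>2 * ?V) * B * B + (B * B * B * ?V) * \<epsilon> * B + (B * B * B * ?V) * B * \<epsilon>"
    using G' dG T w nn by (intro add_mono mult_mono) (auto intro!: mult_nonneg_nonneg)
  also have "\<dots> = 5 * \<epsilon> * B ^ 4 * ?V"
    by (simp add: power2_eq_square power4_eq_xxxx algebra_simps)
  finally show ?thesis .
qed

section \<open>Reduction of the operator and the load to cubic moments\<close>

lemma integral_scaleR_const:
  fixes g :: "'a::euclidean_space \<Rightarrow> real" and v :: "'b::euclidean_space"
  assumes "g integrable_on S"
  shows "integral S (\<lambda>y. (k * g y) *\<^sub>R v) = (k * integral S g) *\<^sub>R v"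
proof -
  have "((\<lambda>y. k * g y) has_integral k * integral S g) S"
    using assms by (intro has_integral_mult_right integrable_integral)
  then show ?thesis
    by (intro integral_unique has_integral_scaleR_left)
qed

text \<open>\<open>R\<close> is the same for all \<open>n\<close> and \<open>p\<close>, so it
  cancels between the perturbed and the exact operator. The dilatation at points other than
  \<open>x\<close> occurs only in \<open>R\<close>.\<close>

lemma LNop_exterior:
  assumes "open \<Omega>"
  obtains R where "\<And>n p. LNop \<delta> \<Omega> \<Gamma> lam mu n p u x = R
    + (8 * theta \<delta> \<Omega> \<Gamma> u x / mdelta \<delta> * (lam * cubic_moment \<delta> (ball x \<delta> - \<Omega>) x n n n
        - (lam + 2 * mu) * cubic_moment \<delta> (ball x \<delta> - \<Omega>) x n p p)) *\<^sub>R n"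
proof -
  let ?E = "ball x \<delta> - \<Omega>"
  have E: "?E \<in> lmeasurable"
    using assms by (intro fmeasurable_Diff) (auto simp: borel_open)
  have 1: "integral ?E (\<lambda>y. ((lam + 2 * mu) * Kker \<delta> (norm (y - x)) * ((y - x) \<bullet> n) * ((y - x) \<bullet> p)\<^sup>2
                  / (norm (y - x))\<^sup>2) *\<^sub>R n) = ((lam + 2 * mu) * cubic_moment \<delta> ?E x n p p) *\<^sub>R n" for n p
    using integral_scaleR_const[OF cubic_moment_integrable[OF E], of "lam + 2 * mu" \<delta> x n p p n]
    by (simp add: cubic_moment_def power2_eq_square mult.assoc)
  have 2: "integral ?E (\<lambda>y. (lam * Kker \<delta> (norm (y - x)) * ((y - x) \<bullet> n) ^ 3 / (norm (y - x))\<^sup>2) *\<^sub>R n)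
      = (lam * cubic_moment \<delta> ?E x n n n) *\<^sub>R n" for n
    using integral_scaleR_const[OF cubic_moment_integrable[OF E], of lam \<delta> x n n n n]
    by (simp add: cubic_moment_def power2_eq_square power3_eq_cube mult.assoc)
  show ?thesis
  proof (rule that)
    fix n p
    show "LNop \<delta> \<Omega> \<Gamma> lam mu n p u x =
      (LNop \<delta> \<Omega> \<Gamma> lam mu 0 0 u x)
    + (8 * theta \<delta> \<Omega> \<Gamma> u x / mdelta \<delta> * (lam * cubic_moment \<delta> ?E x n n n
        - (lam + 2 * mu) * cubic_moment \<delta> ?E x n p p)) *\<^sub>R n"
      unfolding LNop_def Let_def 1 2 C_beta_def
      by (simp add: algebra_simps diff_divide_distrib)
  qed
qed

text \<open>The difference of squares splits the last integral into two moments. The traction is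
  distributed over them so that each term has the shape treated by
  \<open>weighted_cubic_moment_perturbation\<close>.\<close>

lemma fNop_eq_cubic_moments:
  assumes "open \<Omega>"
  shows "fNop \<delta> \<Omega> f n p Tp Tn x = f x
    + (16 / mdelta \<delta> * (cubic_moment \<delta> (ball x \<delta> - \<Omega>) x n p p * Tp)) *\<^sub>R p
    + (8 / mdelta \<delta> * (cubic_moment \<delta> (ball x \<delta> - \<Omega>) x n n n * Tn
        - cubic_moment \<delta> (ball x \<delta> - \<Omega>) x n p p * Tn)) *\<^sub>R n"
proof -
  let ?E = "ball x \<delta> - \<Omega>"
  let ?g = "\<lambda>a b c y. Kker \<delta> (norm (y - x)) *
     ((y - x) \<bullet> a) * ((y - x) \<bullet> b) * ((y - x) \<bullet> c) / (norm (y - x))\<^sup>2"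
  have E: "?E \<in> lmeasurable"
    using assms by (intro fmeasurable_Diff) (auto simp: borel_open)
  note int = cubic_moment_integrable[OF E]
  have 1: "integral ?E (\<lambda>y. (Kker \<delta> (norm (y - x)) * ((y - x) \<bullet> n) * ((y - x) \<bullet> p)\<^sup>2
                  / (norm (y - x))\<^sup>2 * Tp) *\<^sub>R p) = (cubic_moment \<delta> ?E x n p p * Tp) *\<^sub>R p"
    using integral_scaleR_const[OF int, of Tp \<delta> x n p p p]
    by (simp add: cubic_moment_def power2_eq_square mult_ac)
  have "integral ?E (\<lambda>y. (Tn * (?g n n n y - ?g n p p y)) *\<^sub>R n)
      = (Tn * (cubic_moment \<delta> ?E x n n n - cubic_moment \<delta> ?E x n p p)) *\<^sub>R n"
    unfolding cubic_moment_def
    by (simp only: integral_scaleR_const[OF integrable_diff[OF int int]] integral_diff[OF int int])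
  moreover have "Tn * (k * s * s * s / N - k * s * t * t / N) = k * s * (s\<^sup>2 - t\<^sup>2) / N * Tn" for k s t N
    by (simp add: power2_eq_square algebra_simps diff_divide_distrib)
  ultimately have 2: "integral ?E (\<lambda>y. (Kker \<delta> (norm (y - x)) * ((y - x) \<bullet> n) *
      (((y - x) \<bullet> n)\<^sup>2 - ((y - x) \<bullet> p)\<^sup>2) / (norm (y - x))\<^sup>2 * Tn) *\<^sub>R n)
      = (Tn * (cubic_moment \<delta> ?E x n n n - cubic_moment \<delta> ?E x n p p)) *\<^sub>R n"
    by (simp only:)
  show ?thesis
    unfolding fNop_def Let_def 1 2 C_beta_def by (simp add: algebra_simps diff_divide_distrib)
qed

section \<open>Size of the exact traction\<close>

lemma abs_div2_le:
  assumes "\<And>v. norm (frechet_derivative u (at x) v) \<le> L * norm v"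
  shows "\<bar>div2 u x\<bar> \<le> 2 * L"
proof -
  have "\<bar>frechet_derivative u (at x) (axis i 1) $ i\<bar> \<le> L" for i
    using component_le_norm_cart[of "frechet_derivative u (at x) (axis i 1)" i] assms[of "axis i 1"]
    by simp
  from this[of 1] this[of 2] show ?thesis
    unfolding div2_def sum_2 by linarith
qed

lemma abs_inner_frechet_derivative_le:
  assumes "\<And>v. norm (frechet_derivative u (at x) v) \<le> L * norm v" "0 \<le> L"
    and "norm a \<le> B" "norm b \<le> B"
  shows "\<bar>a \<bullet> frechet_derivative u (at x) b\<bar> \<le> L * B\<^sup>2"
proof -
  have "0 \<le> B"
    using assms(3) norm_ge_zero order_trans by blast
  have "\<bar>a \<bullet> frechet_derivative u (at x) b\<bar> \<le> norm a * norm (frechet_derivative u (at x) b)"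
    by (rule Cauchy_Schwarz_ineq2)
  also have "\<dots> \<le> B * (L * B)"
    using assms \<open>0 \<le> B\<close> order_trans[OF assms(1)[of b] mult_left_mono[OF assms(4,2)]]
    by (intro mult_mono) auto
  finally show ?thesis
    by (simp add: power2_eq_square mult_ac)
qed

section \<open>The uniform estimate\<close>

theorem theorem6:
  fixes \<Omega> \<Gamma>N :: "vec2 set" and lam mu M :: real
    and u f :: "vec2 \<Rightarrow> vec2"
    and nh ph :: "real \<Rightarrow> vec2 \<Rightarrow> vec2"
    and Tph Tnh :: "real \<Rightarrow> vec2 \<Rightarrow> real"
  defines "nrm \<equiv> \<lambda>x. out_normal \<Omega> (nearest \<Gamma>N x)"
      and "tng \<equiv> \<lambda>x. tangent_of (out_normal \<Omega> (nearest \<Gamma>N x))"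
  assumes dom: "bounded_domain \<Omega>" and bdry: "C3_boundary \<Omega>"
    and GN: "\<Gamma>N \<subseteq> frontier \<Omega>" "closed \<Gamma>N"
    and lame: "lam > 0" "mu > 0"
    and Mpos: "M > 0"
    and C1: "\<exists>U. open U \<and> closure \<Omega> \<subseteq> U \<and> (\<forall>x\<in>U. u differentiable (at x))
              \<and> (\<forall>v. continuous_on U (\<lambda>x. frechet_derivative u (at x) v))"
    and pert: "\<exists>C h1. h1 > 0 \<and> (\<forall>h. 0 < h \<and> h \<le> h1 \<longrightarrow>
                 (\<forall>x\<in>IOmegaN (M * h) \<Omega> \<Gamma>N.
                    norm (nh h x) = 1 \<and> norm (ph h x) = 1 \<and> nh h x \<bullet> ph h x = 0
                  \<and> norm (nh h x - nrm x) \<le> C * h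
                  \<and> norm (ph h x - tng x) \<le> C * h
                  \<and> \<bar>Tph h (nearest \<Gamma>N x) - Tp_exact mu u (nrm x) (tng x) x\<bar> \<le> C * h
                  \<and> \<bar>Tnh h (nearest \<Gamma>N x) - Tn_exact lam mu u (nrm x) x\<bar> \<le> C * h))"
  shows "\<exists>C h0. h0 > 0 \<and> (\<forall>h. 0 < h \<and> h \<le> h0 \<longrightarrow>
           (\<forall>x\<in>IOmegaN (M * h) \<Omega> \<Gamma>N.
              norm (LNop (M * h) \<Omega> \<Gamma>N lam mu (nh h x) (ph h x) u x
                    - fNop (M * h) \<Omega> f (nh h x) (ph h x) (Tph h (nearest \<Gamma>N x)) (Tnh h (nearest \<Gamma>N x)) x
                    - LNop (M * h) \<Omega> \<Gamma>N lam mu (nrm x) (tng x) u x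
                    + fNop (M * h) \<Omega> f (nrm x) (tng x)
                        (Tp_exact mu u (nrm x) (tng x) x) (Tn_exact lam mu u (nrm x) x) x)
              \<le> C))"
proof -
  obtain C h1 where h1: "h1 > 0" and pert': "\<And>h x. 0 < h \<Longrightarrow> h \<le> h1 \<Longrightarrow> x \<in> IOmegaN (M * h) \<Omega> \<Gamma>N \<Longrightarrow>
       norm (nh h x) = 1 \<and> norm (ph h x) = 1
       \<and> norm (nh h x - nrm x) \<le> C * h \<and> norm (ph h x - tng x) \<le> C * h
       \<and> \<bar>Tph h (nearest \<Gamma>N x) - Tp_exact mu u (nrm x) (tng x) x\<bar> \<le> C * h
       \<and> \<bar>Tnh h (nearest \<Gamma>N x) - Tn_exact lam mu u (nrm x) x\<bar> \<le> C * h"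
    using pert by metis
  have \<Omega>: "open \<Omega>" "compact (closure \<Omega>)"
    using dom by (auto simp: bounded_domain_def)
  obtain U where "open U" "closure \<Omega> \<subseteq> U" "\<And>x. x \<in> U \<Longrightarrow> u differentiable (at x)"
      "\<And>v. continuous_on U (\<lambda>x. frechet_derivative u (at x) v)"
    using C1 by metis
  then obtain L r where L: "0 \<le> L" "0 < r"
      "\<And>x v. x \<in> closure \<Omega> \<Longrightarrow> norm (frechet_derivative u (at x) v) \<le> L * norm v"
      "\<And>x y. x \<in> closure \<Omega> \<Longrightarrow> dist x y < r \<Longrightarrow> norm (u y - u x) \<le> L * norm (y - x)"
    using C1_near_compact_bounds[OF \<Omega>(2)] by metis
  obtain e where e: "0 < e"
      "\<And>x \<delta>. x \<in> \<Omega> \<Longrightarrow> 0 < \<delta> \<Longrightarrow> \<delta> \<le> e \<Longrightarrow> \<exists>c. ball c (e * \<delta>) \<subseteq> ball x \<delta> \<inter> \<Omega>"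
    using uniform_interior_balls[OF dom bdry] by metis
  \<comment> \<open>The four bounds give, in turn: the perturbation hypotheses,
    \<open>\<epsilon> \<le> |C|\<close>, \<open>\<delta> \<le> r\<close> for the Lipschitz bound on
    \<open>u\<close>, and \<open>\<delta> \<le> e\<close> for the interior balls.\<close>
  define h0 where "h0 = min (min h1 1) (min (r / M) (e / M))"
  \<comment> \<open>\<open>B0\<close> bounds the exact normal and tangent through their distance to
    the perturbed unit vectors, so no property of the choice in \<open>out_normal\<close> is
    invoked. The extra term in \<open>B\<close> bounds the exact tractions, and the
    \<open>|C|\<close> in \<open>B0\<close> covers their perturbation.\<close>
  define B0 where "B0 = 1 + \<bar>C\<bar>"
  define B where "B = B0 + 2 * L * (lam + mu) * B0\<^sup>2"
  define \<Theta> where "\<Theta> = 128 * (L * 128 / e ^ 4)"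
  \<comment> \<open>The sum of the coefficients of the five differences \<open>d1\<close> to
    \<open>d5\<close> below, without the factor \<open>1/m\<close>; 32 is 16 + 8 + 8 from the
    load.\<close>
  define W where "W = 8 * \<Theta> * lam + 8 * \<Theta> * (lam + 2 * mu) + 32"
  have "0 \<le> \<Theta>"
    using L e by (simp add: \<Theta>_def)
  have B0: "1 \<le> B0" "1 \<le> B0\<^sup>2"
    by (auto simp: B0_def)
  have Bge: "B0 \<le> B" "1 \<le> B"
    using B0 L(1) lame by (auto simp: B_def add_increasing2)
  have "norm (LNop (M * h) \<Omega> \<Gamma>N lam mu (nh h x) (ph h x) u x
              - fNop (M * h) \<Omega> f (nh h x) (ph h x) (Tph h (nearest \<Gamma>N x)) (Tnh h (nearest \<Gamma>N x)) x
              - LNop (M * h) \<Omega> \<Gamma>N lam mu (nrm x) (tng x) u x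
              + fNop (M * h) \<Omega> f (nrm x) (tng x)
                  (Tp_exact mu u (nrm x) (tng x) x) (Tn_exact lam mu u (nrm x) x) x)
        \<le> W * (320 * \<bar>C\<bar> * B ^ 4 / M)"
    if h: "0 < h" "h \<le> h0" and x: "x \<in> IOmegaN (M * h) \<Omega> \<Gamma>N" for h x
  proof -
    define \<delta> where "\<delta> = M * h"
    define n p where "n = nrm x" and "p = tng x"
    define n' p' where "n' = nh h x" and "p' = ph h x"
    define Tp Tn where "Tp = Tp_exact mu u n p x" and "Tn = Tn_exact lam mu u n x"
    define Tp' Tn' where "Tp' = Tph h (nearest \<Gamma>N x)" and "Tn' = Tnh h (nearest \<Gamma>N x)"
    \<comment> \<open>The sign of \<open>C\<close> is not known, hence the absolute value.\<close>
    define \<epsilon> where "\<epsilon> = \<bar>C\<bar> * h"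
    define E where "E = ball x \<delta> - \<Omega>"
    define \<theta> where "\<theta> = theta \<delta> \<Omega> \<Gamma>N u x"
    define m where "m = mdelta \<delta>"
    have h': "h \<le> h1" "h \<le> 1" "h \<le> r / M" "h \<le> e / M"
      using h by (auto simp: h0_def)
    have \<delta>: "0 < \<delta>" "\<delta> \<le> r" "\<delta> \<le> e"
      using h h' Mpos by (auto simp: \<delta>_def field_simps)
    have m: "0 < m" "\<delta> ^ 3 * pi / 64 \<le> m"
      using mdelta_pos[OF \<delta>(1)] mdelta_ge[of \<delta>] \<delta> by (auto simp: m_def)
    have "x \<in> \<Omega>"
      using x by (simp add: IOmegaN_def)
    then have xc: "x \<in> closure \<Omega>"
      using closure_subset by blast
    have E: "E \<in> lmeasurable" "E \<subseteq> ball x \<delta>"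
      using \<Omega> unfolding E_def by (auto intro!: fmeasurable_Diff simp: borel_open)
    have Ch: "C * h \<le> \<epsilon>" "\<epsilon> \<le> \<bar>C\<bar>" "0 \<le> \<epsilon>"
      using h h' by (auto simp: \<epsilon>_def mult_right_mono mult_left_le)
    have pert_x: "norm n' = 1" "norm p' = 1" "norm (n' - n) \<le> \<epsilon>" "norm (p' - p) \<le> \<epsilon>"
      "\<bar>Tp' - Tp\<bar> \<le> \<epsilon>" "\<bar>Tn' - Tn\<bar> \<le> \<epsilon>"
      using pert'[OF h(1) h'(1) x] Ch
      unfolding n_def p_def n'_def p'_def Tp_def Tn_def Tp'_def Tn'_def by auto
    have np: "norm n \<le> B0" "norm p \<le> B0"
      using norm_triangle_ineq3[of n' n] norm_triangle_ineq3[of p' p] pert_x Ch by (auto simp: B0_def)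
    have D: "norm (frechet_derivative u (at x) v) \<le> L * norm v" for v
      using L(3)[OF xc] .
    note D2 = abs_inner_frechet_derivative_le[OF D L(1)]
    have "\<bar>Tp\<bar> \<le> mu * (L * B0\<^sup>2 + L * B0\<^sup>2)"
      unfolding Tp_def Tp_exact_def
      using D2[OF np(2,1)] D2[OF np(1,2)] lame by (auto simp: abs_mult intro!: mult_left_mono)
    moreover have "0 \<le> L * (lam * (2 * B0\<^sup>2))"
      using L(1) lame by simp
    ultimately have TpB: "\<bar>Tp\<bar> \<le> 2 * L * (lam + mu) * B0\<^sup>2"
      by (simp add: algebra_simps)
    have "\<bar>Tn\<bar> \<le> lam * (2 * L) + 2 * mu * (L * B0\<^sup>2)"
    proof -
      have "\<bar>Tn\<bar> \<le> \<bar>lam * div2 u x\<bar> + \<bar>2 * mu * (n \<bullet> frechet_derivative u (at x) n)\<bar>"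
        unfolding Tn_def Tn_exact_def by (rule abs_triangle_ineq)
      also have "\<dots> \<le> lam * (2 * L) + 2 * mu * (L * B0\<^sup>2)"
        using abs_div2_le[OF D] D2[OF np(1,1)] lame
        by (intro add_mono) (auto simp: abs_mult intro!: mult_left_mono)
      finally show ?thesis .
    qed
    moreover have "lam * (2 * L) \<le> lam * (2 * L) * B0\<^sup>2"
      using mult_left_mono[OF B0(2), of "lam * (2 * L)"] L(1) lame by simp
    ultimately have TnB: "\<bar>Tn\<bar> \<le> 2 * L * (lam + mu) * B0\<^sup>2"
      by (simp add: algebra_simps)
    have bounds: "norm n' \<le> B" "norm p' \<le> B" "norm n \<le> B" "norm p \<le> B"
      "\<bar>Tp\<bar> \<le> B" "\<bar>Tn\<bar> \<le> B" "\<bar>Tp'\<bar> \<le> B" "\<bar>Tn'\<bar> \<le> B"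
      using TpB TnB np pert_x Ch Bge B0 B_def B0_def by linarith+
    have "\<bar>\<theta>\<bar> \<le> \<Theta>"
    proof -
      obtain c where "ball c (e * \<delta>) \<subseteq> ball x \<delta> \<inter> \<Omega>"
        using e(2)[OF \<open>x \<in> \<Omega>\<close> \<delta>(1,3)] by blast
      then have "\<bar>theta_corr \<delta> \<Omega> u x\<bar> \<le> \<Theta>"
        unfolding \<Theta>_def using \<delta> L(4)[OF xc] by (intro theta_corr_bound e \<Omega> L(1)) auto
      \<comment> \<open>Since \<open>x\<close> lies in \<open>IOmegaN\<close>, \<open>theta\<close>
        is the corrected dilatation there.\<close>
      then show ?thesis
        using x by (simp add: \<theta>_def theta_def \<delta>_def)
    qed
    let ?G = "cubic_moment \<delta> E x"
    define D0 where "D0 = 5 * \<epsilon> * B ^ 4 * (\<delta>\<^sup>2 * pi)"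
    note diff = weighted_cubic_moment_perturbation[OF E less_imp_le[OF \<delta>(1)]]
    \<comment> \<open>In the operator the dilatation is the same before and after perturbation, so
      it stays outside as a coefficient and the weight is 1. In the load the weight is the traction,
      which is perturbed too.\<close>
    define d1 where "d1 = (?G n' p' p' * 1) *\<^sub>R n' - (?G n p p * 1) *\<^sub>R n"
    define d2 where "d2 = (?G n' n' n' * 1) *\<^sub>R n' - (?G n n n * 1) *\<^sub>R n"
    define d3 where "d3 = (?G n' p' p' * Tp') *\<^sub>R p' - (?G n p p * Tp) *\<^sub>R p"
    define d4 where "d4 = (?G n' n' n' * Tn') *\<^sub>R n' - (?G n n n * Tn) *\<^sub>R n"
    define d5 where "d5 = (?G n' p' p' * Tn') *\<^sub>R n' - (?G n p p * Tn) *\<^sub>R n"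
    have one: "\<bar>1::real\<bar> \<le> B" "\<bar>1 - 1::real\<bar> \<le> \<epsilon>"
      using Bge(2) Ch(3) by auto
    have d: "norm d1 \<le> D0" "norm d2 \<le> D0" "norm d3 \<le> D0" "norm d4 \<le> D0" "norm d5 \<le> D0"
      unfolding d1_def d2_def d3_def d4_def d5_def D0_def
      by (rule diff; fact)+
    obtain R where R: "\<And>n p. LNop \<delta> \<Omega> \<Gamma>N lam mu n p u x = R
        + (8 * \<theta> / m * (lam * ?G n n n - (lam + 2 * mu) * ?G n p p)) *\<^sub>R n"
      using LNop_exterior[OF \<Omega>(1)] unfolding E_def \<theta>_def m_def by blast
    have F: "fNop \<delta> \<Omega> f n p Tp Tn x = f x + (16 / m * (?G n p p * Tp)) *\<^sub>R p
        + (8 / m * (?G n n n * Tn - ?G n p p * Tn)) *\<^sub>R n" for n p Tp Tn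
      using fNop_eq_cubic_moments[OF \<Omega>(1)] unfolding E_def m_def by blast
    have tri: "norm (a - b - c - d + e) \<le> norm a + norm b + norm c + norm d + norm e" for a b c d e :: vec2
      by norm
    \<comment> \<open>\<open>R\<close> and \<open>f x\<close> cancel, leaving only the five
      differences.\<close>
    have "LNop \<delta> \<Omega> \<Gamma>N lam mu n' p' u x - fNop \<delta> \<Omega> f n' p' Tp' Tn' x
        - LNop \<delta> \<Omega> \<Gamma>N lam mu n p u x + fNop \<delta> \<Omega> f n p Tp Tn x
      = (8 * \<theta> / m * lam) *\<^sub>R d2 - (8 * \<theta> / m * (lam + 2 * mu)) *\<^sub>R d1
        - (16 / m) *\<^sub>R d3 - (8 / m) *\<^sub>R d4 + (8 / m) *\<^sub>R d5" (is "?lhs = ?rhs")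
      unfolding R F d1_def d2_def d3_def d4_def d5_def
      by (simp add: scaleR_diff_right scaleR_diff_left right_diff_distrib diff_divide_distrib mult.assoc)
    also have "norm ?rhs \<le> norm ((8 * \<theta> / m * lam) *\<^sub>R d2) + norm ((8 * \<theta> / m * (lam + 2 * mu)) *\<^sub>R d1)
        + norm ((16 / m) *\<^sub>R d3) + norm ((8 / m) *\<^sub>R d4) + norm ((8 / m) *\<^sub>R d5)"
      by (rule tri)
    also have "\<dots> \<le> 8 * \<Theta> / m * lam * D0 + 8 * \<Theta> / m * (lam + 2 * mu) * D0 + 16 / m * D0 + 8 / m * D0 + 8 / m * D0"
      using d m lame \<open>\<bar>\<theta>\<bar> \<le> \<Theta>\<close> \<open>0 \<le> \<Theta>\<close>
      by (intro add_mono) (auto simp: abs_mult intro!: mult_mono divide_right_mono)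
    also have "\<dots> = W * (D0 / m)"
      using m by (simp add: W_def field_simps)
    also have "\<dots> \<le> W * (320 * \<bar>C\<bar> * B ^ 4 / M)"
    proof (rule mult_left_mono)
      \<comment> \<open>Numerator \<open>O(\<epsilon> * \<delta>^2)\<close> over denominator of
        order \<open>\<delta>^3\<close> leaves \<open>\<epsilon> / \<delta>\<close>, which
        M-convergence makes the constant \<open>|C| / M\<close>; 320 is 5 times 64.\<close>
      have "D0 / m \<le> D0 / (\<delta> ^ 3 * pi / 64)"
        using m \<delta> Ch by (intro divide_left_mono) (auto simp: D0_def)
      also have "\<dots> = 320 * \<epsilon> * B ^ 4 / \<delta>"
        using \<delta> by (simp add: D0_def power2_eq_square power3_eq_cube)
      also have "\<dots> = 320 * \<bar>C\<bar> * B ^ 4 / M"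
        using h Mpos by (simp add: \<epsilon>_def \<delta>_def)
      finally show "D0 / m \<le> 320 * \<bar>C\<bar> * B ^ 4 / M" .
      show "0 \<le> W"
        using \<open>0 \<le> \<Theta>\<close> lame by (simp add: W_def)
    qed
    finally show ?thesis
      unfolding \<delta>_def n_def p_def n'_def p'_def Tp_def Tn_def Tp'_def Tn'_def .
  qed
  moreover have "0 < h0"
    using h1 L e Mpos by (simp add: h0_def)
  ultimately show ?thesis
    by blast
qed

end
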